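(* A tower of rings $A\,|\,B\,|\,C$ is right depth three if and only if there exist a positive integer $N$ and elements $\gamma_1,\dots,\gamma_N\in \operatorname{End}{}_BA_C$ and $u_1,\dots,u_N\in (A\otimes_B A)^C$ such that for all $x,y\in A$, $$x\otimes_B y=\sum_{i=1}^N x\gamma_i(y)u_i .$$
   Context: Rings have identity; a tower of rings $A\,|\,B\,|\,C$ is a pair of unital ring homomorphisms $C\to B\to A$, inducing natural bimodule structures. The tower is right depth three if for some positive integer $N$ the bimodule $A\otimes_B A$ is isomorphic, as an $A$-$C$-bimodule, to a direct summand of $A^N$. $\operatorname{End}{}_BA_C$ is the ring of $B$-$C$-bimodule endomorphisms of $A$, and $(A\otimes_B A)^C=\{p\in A\otimes_B A: cp=pc\ \forall c\in C\}$. *)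

theory Defs
  imports "HOL-Algebra.AbelCoset" "HOL-Algebra.Module" "HOL-Algebra.Generated_Groups" "HOL-Algebra.Free_Abelian_Groups"
begin

locale ring_tower = A: ring A + B: ring B + C: ring C
  for A :: "('a, 'm) ring_scheme"
    and B :: "('b, 'n) ring_scheme"
    and C :: "('c, 'k) ring_scheme" +
  fixes \<phi> :: "'c \<Rightarrow> 'b" and \<psi> :: "'b \<Rightarrow> 'a"
  assumes phi_hom: "\<phi> \<in> ring_hom C B"
    and psi_hom: "\<psi> \<in> ring_hom B A"

section \<open>Bimodules\<close>

text \<open>As in \<^theory>\<open>HOL-Algebra.Module\<close>, the underlying additive group is carried by a ring record;
  its multiplication and unit are never used.\<close>

record ('r, 's, 'm) bimodule = "'m ring" +
  lsmult :: "'r \<Rightarrow> 'm \<Rightarrow> 'm"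
  rsmult :: "'m \<Rightarrow> 's \<Rightarrow> 'm"

locale bimodule = R: ring R + S: ring S + abelian_group M
  for R :: "('r, 'x) ring_scheme"
    and S :: "('s, 'y) ring_scheme"
    and M :: "('r, 's, 'm) bimodule" (structure) +
  assumes lsmult_closed: "\<lbrakk>r \<in> carrier R; x \<in> carrier M\<rbrakk> \<Longrightarrow> lsmult M r x \<in> carrier M"
    and rsmult_closed: "\<lbrakk>s \<in> carrier S; x \<in> carrier M\<rbrakk> \<Longrightarrow> rsmult M x s \<in> carrier M"
    and lsmult_add: "\<lbrakk>r \<in> carrier R; x \<in> carrier M; y \<in> carrier M\<rbrakk>
      \<Longrightarrow> lsmult M r (x \<oplus> y) = lsmult M r x \<oplus> lsmult M r y"
    and rsmult_add: "\<lbrakk>s \<in> carrier S; x \<in> carrier M; y \<in> carrier M\<rbrakk>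
      \<Longrightarrow> rsmult M (x \<oplus> y) s = rsmult M x s \<oplus> rsmult M y s"
    and add_lsmult: "\<lbrakk>r \<in> carrier R; r' \<in> carrier R; x \<in> carrier M\<rbrakk>
      \<Longrightarrow> lsmult M (r \<oplus>\<^bsub>R\<^esub> r') x = lsmult M r x \<oplus> lsmult M r' x"
    and add_rsmult: "\<lbrakk>s \<in> carrier S; s' \<in> carrier S; x \<in> carrier M\<rbrakk>
      \<Longrightarrow> rsmult M x (s \<oplus>\<^bsub>S\<^esub> s') = rsmult M x s \<oplus> rsmult M x s'"
    and mult_lsmult: "\<lbrakk>r \<in> carrier R; r' \<in> carrier R; x \<in> carrier M\<rbrakk>
      \<Longrightarrow> lsmult M (r \<otimes>\<^bsub>R\<^esub> r') x = lsmult M r (lsmult M r' x)"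
    and mult_rsmult: "\<lbrakk>s \<in> carrier S; s' \<in> carrier S; x \<in> carrier M\<rbrakk>
      \<Longrightarrow> rsmult M x (s \<otimes>\<^bsub>S\<^esub> s') = rsmult M (rsmult M x s) s'"
    and one_lsmult: "x \<in> carrier M \<Longrightarrow> lsmult M \<one>\<^bsub>R\<^esub> x = x"
    and one_rsmult: "x \<in> carrier M \<Longrightarrow> rsmult M x \<one>\<^bsub>S\<^esub> = x"
    and lsmult_rsmult: "\<lbrakk>r \<in> carrier R; s \<in> carrier S; x \<in> carrier M\<rbrakk>
      \<Longrightarrow> rsmult M (lsmult M r x) s = lsmult M r (rsmult M x s)"

definition bimodule_hom ::
  "('r, 'x) ring_scheme \<Rightarrow> ('s, 'y) ring_scheme \<Rightarrow>
   ('r, 's, 'm) bimodule \<Rightarrow> ('r, 's, 'n) bimodule \<Rightarrow> ('m \<Rightarrow> 'n) set" where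
  "bimodule_hom R S M N =
    {h. h \<in> carrier M \<rightarrow> carrier N \<and>
      (\<forall>x\<in>carrier M. \<forall>y\<in>carrier M. h (x \<oplus>\<^bsub>M\<^esub> y) = h x \<oplus>\<^bsub>N\<^esub> h y) \<and>
      (\<forall>r\<in>carrier R. \<forall>x\<in>carrier M. h (lsmult M r x) = lsmult N r (h x)) \<and>
      (\<forall>s\<in>carrier S. \<forall>x\<in>carrier M. h (rsmult M x s) = rsmult N (h x) s)}"

definition bimodule_iso ::
  "('r, 'x) ring_scheme \<Rightarrow> ('s, 'y) ring_scheme \<Rightarrow>
   ('r, 's, 'm) bimodule \<Rightarrow> ('r, 's, 'n) bimodule \<Rightarrow> ('m \<Rightarrow> 'n) set" where
  "bimodule_iso R S M N = {h \<in> bimodule_hom R S M N. bij_betw h (carrier M) (carrier N)}"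

definition subbimodule ::
  "('r, 'x) ring_scheme \<Rightarrow> ('s, 'y) ring_scheme \<Rightarrow> 'm set \<Rightarrow> ('r, 's, 'm) bimodule \<Rightarrow> bool" where
  "subbimodule R S P M \<longleftrightarrow> additive_subgroup P M \<and>
    (\<forall>r\<in>carrier R. \<forall>x\<in>P. lsmult M r x \<in> P) \<and>
    (\<forall>s\<in>carrier S. \<forall>x\<in>P. rsmult M x s \<in> P)"

definition direct_summand ::
  "('r, 'x) ring_scheme \<Rightarrow> ('s, 'y) ring_scheme \<Rightarrow> 'm set \<Rightarrow> ('r, 's, 'm) bimodule \<Rightarrow> bool" where
  "direct_summand R S P M \<longleftrightarrow> subbimodule R S P M \<and>
    (\<exists>Q. subbimodule R S Q M \<and> P \<inter> Q = {\<zero>\<^bsub>M\<^esub>} \<and> P <+>\<^bsub>M\<^esub> Q = carrier M)"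

definition centralizer :: "('r, 'x) ring_scheme \<Rightarrow> ('r, 'r, 'm) bimodule \<Rightarrow> 'm set" where
  "centralizer R M = {p \<in> carrier M. \<forall>r\<in>carrier R. lsmult M r p = rsmult M p r}"

definition regular_bimodule :: "('a, 'x) ring_scheme \<Rightarrow> ('a, 'a, 'a) bimodule" where
  "regular_bimodule R =
    \<lparr>carrier = carrier R, monoid.mult = monoid.mult R, one = one R, ring.zero = ring.zero R, add = add R,
     lsmult = monoid.mult R, rsmult = monoid.mult R\<rparr>"

definition restrict_scalars ::
  "('r \<Rightarrow> 'p) \<Rightarrow> ('s \<Rightarrow> 'q) \<Rightarrow> ('p, 'q, 'm) bimodule \<Rightarrow> ('r, 's, 'm) bimodule" where
  "restrict_scalars f g M =
    \<lparr>carrier = carrier M, monoid.mult = monoid.mult M, one = one M, ring.zero = ring.zero M, add = add M,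
     lsmult = (\<lambda>r. lsmult M (f r)), rsmult = (\<lambda>x s. rsmult M x (g s))\<rparr>"

definition power_bimodule ::
  "('r, 's, 'm) bimodule \<Rightarrow> nat \<Rightarrow> ('r, 's, nat \<Rightarrow> 'm) bimodule" where
  "power_bimodule M N =
    \<lparr>carrier = {1..N} \<rightarrow>\<^sub>E carrier M, monoid.mult = undefined, one = undefined,
     ring.zero = (\<lambda>i\<in>{1..N}. \<zero>\<^bsub>M\<^esub>), add = (\<lambda>v w. \<lambda>i\<in>{1..N}. v i \<oplus>\<^bsub>M\<^esub> w i),
     lsmult = (\<lambda>r v. \<lambda>i\<in>{1..N}. lsmult M r (v i)),
     rsmult = (\<lambda>v s. \<lambda>i\<in>{1..N}. rsmult M (v i) s)\<rparr>"

section \<open>Tensor products\<close>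

text \<open>For an \<open>R\<close>-\<open>B\<close>-bimodule \<open>M\<close> and a \<open>B\<close>-\<open>S\<close>-bimodule \<open>N\<close>, the \<open>R\<close>-\<open>S\<close>-bimodule
  \<open>M \<otimes>\<^sub>B N\<close> is the free abelian group on \<open>M \<times> N\<close> modulo the subgroup generated by the
  biadditivity and balancing relations. The free abelian group is written additively through
  its \<open>poly_mapping\<close> elements, so its subtraction is that of the type.\<close>

abbreviation tensor_free ::
  "('r, 'b, 'm) bimodule \<Rightarrow> ('b, 's, 'n) bimodule \<Rightarrow> (('m \<times> 'n) \<Rightarrow>\<^sub>0 int) monoid" where
  "tensor_free M N \<equiv> free_Abelian_group (carrier M \<times> carrier N)"

definition tensor_relations ::
  "('r, 'b, 'm) bimodule \<Rightarrow> ('b, 'x) ring_scheme \<Rightarrow> ('b, 's, 'n) bimodule \<Rightarrow>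
   (('m \<times> 'n) \<Rightarrow>\<^sub>0 int) set" where
  "tensor_relations M B N = generate (tensor_free M N)
    ({frag_of (x \<oplus>\<^bsub>M\<^esub> x', y) - frag_of (x, y) - frag_of (x', y) | x x' y.
        x \<in> carrier M \<and> x' \<in> carrier M \<and> y \<in> carrier N} \<union>
     {frag_of (x, y \<oplus>\<^bsub>N\<^esub> y') - frag_of (x, y) - frag_of (x, y') | x y y'.
        x \<in> carrier M \<and> y \<in> carrier N \<and> y' \<in> carrier N} \<union>
     {frag_of (rsmult M x b, y) - frag_of (x, lsmult N b y) | x b y.
        x \<in> carrier M \<and> b \<in> carrier B \<and> y \<in> carrier N})"

abbreviation tensor_quotient ::
  "('r, 'b, 'm) bimodule \<Rightarrow> ('b, 'x) ring_scheme \<Rightarrow> ('b, 's, 'n) bimodule \<Rightarrow>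
   (('m \<times> 'n) \<Rightarrow>\<^sub>0 int) set monoid" where
  "tensor_quotient M B N \<equiv> tensor_free M N Mod tensor_relations M B N"

definition tensor_elem ::
  "('r, 'b, 'm) bimodule \<Rightarrow> ('b, 'x) ring_scheme \<Rightarrow> ('b, 's, 'n) bimodule \<Rightarrow>
   'm \<Rightarrow> 'n \<Rightarrow> (('m \<times> 'n) \<Rightarrow>\<^sub>0 int) set" where
  "tensor_elem M B N x y = tensor_relations M B N #>\<^bsub>tensor_free M N\<^esub> frag_of (x, y)"

text \<open>The action of a scalar is the endomorphism of the quotient induced by the additive
  extension of \<open>(x, y) \<mapsto> (r \<cdot> x, y)\<close> or \<open>(x, y) \<mapsto> (x, y \<cdot> s)\<close>. The union below is one over equal
  cosets, indexed by the representatives of a coset.\<close>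

definition tensor_bimodule ::
  "('r, 'b, 'm) bimodule \<Rightarrow> ('b, 'x) ring_scheme \<Rightarrow> ('b, 's, 'n) bimodule \<Rightarrow>
   ('r, 's, (('m \<times> 'n) \<Rightarrow>\<^sub>0 int) set) bimodule" where
  "tensor_bimodule M B N =
    \<lparr>carrier = carrier (tensor_quotient M B N), monoid.mult = undefined, one = undefined,
     ring.zero = one (tensor_quotient M B N), add = monoid.mult (tensor_quotient M B N),
     lsmult = (\<lambda>r U. \<Union>c\<in>U. tensor_relations M B N #>\<^bsub>tensor_free M N\<^esub>
       frag_extend (\<lambda>(x, y). frag_of (lsmult M r x, y)) c),
     rsmult = (\<lambda>U s. \<Union>c\<in>U. tensor_relations M B N #>\<^bsub>tensor_free M N\<^esub>
       frag_extend (\<lambda>(x, y). frag_of (x, rsmult N y s)) c)\<rparr>"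

section \<open>Towers of rings\<close>

text \<open>\<open>A \<otimes>\<^sub>B A\<close> as an \<open>A\<close>-\<open>A\<close>-bimodule, for a ring homomorphism \<open>\<psi>: B \<rightarrow> A\<close>.\<close>

definition tensor_square ::
  "('a, 'm) ring_scheme \<Rightarrow> ('b, 'n) ring_scheme \<Rightarrow> ('b \<Rightarrow> 'a) \<Rightarrow>
   ('a, 'a, (('a \<times> 'a) \<Rightarrow>\<^sub>0 int) set) bimodule" where
  "tensor_square A B \<psi> =
    tensor_bimodule (restrict_scalars id \<psi> (regular_bimodule A)) B
      (restrict_scalars \<psi> id (regular_bimodule A))"

definition pure_tensor ::
  "('a, 'm) ring_scheme \<Rightarrow> ('b, 'n) ring_scheme \<Rightarrow> ('b \<Rightarrow> 'a) \<Rightarrow>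
   'a \<Rightarrow> 'a \<Rightarrow> (('a \<times> 'a) \<Rightarrow>\<^sub>0 int) set" where
  "pure_tensor A B \<psi> =
    tensor_elem (restrict_scalars id \<psi> (regular_bimodule A)) B
      (restrict_scalars \<psi> id (regular_bimodule A))"

definition right_depth_three ::
  "('a, 'm) ring_scheme \<Rightarrow> ('b, 'n) ring_scheme \<Rightarrow> ('c, 'k) ring_scheme \<Rightarrow>
   ('c \<Rightarrow> 'b) \<Rightarrow> ('b \<Rightarrow> 'a) \<Rightarrow> bool" where
  "right_depth_three A B C \<phi> \<psi> \<longleftrightarrow>
    (\<exists>N::nat. N \<ge> 1 \<and>
      (let T = restrict_scalars id (\<psi> \<circ> \<phi>) (tensor_square A B \<psi>);
           AN = power_bimodule (restrict_scalars id (\<psi> \<circ> \<phi>) (regular_bimodule A)) N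
       in \<exists>P. direct_summand A C P AN \<and> bimodule_iso A C T (AN\<lparr>carrier := P\<rparr>) \<noteq> {}))"

definition End_BAC ::
  "('a, 'm) ring_scheme \<Rightarrow> ('b, 'n) ring_scheme \<Rightarrow> ('c, 'k) ring_scheme \<Rightarrow>
   ('c \<Rightarrow> 'b) \<Rightarrow> ('b \<Rightarrow> 'a) \<Rightarrow> ('a \<Rightarrow> 'a) set" where
  "End_BAC A B C \<phi> \<psi> =
    bimodule_hom B C (restrict_scalars \<psi> (\<psi> \<circ> \<phi>) (regular_bimodule A))
      (restrict_scalars \<psi> (\<psi> \<circ> \<phi>) (regular_bimodule A))"

definition tensor_square_centralizer ::
  "('a, 'm) ring_scheme \<Rightarrow> ('b, 'n) ring_scheme \<Rightarrow> ('c, 'k) ring_scheme \<Rightarrow>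
   ('c \<Rightarrow> 'b) \<Rightarrow> ('b \<Rightarrow> 'a) \<Rightarrow> (('a \<times> 'a) \<Rightarrow>\<^sub>0 int) set set" where
  "tensor_square_centralizer A B C \<phi> \<psi> =
    centralizer C (restrict_scalars (\<psi> \<circ> \<phi>) (\<psi> \<circ> \<phi>) (tensor_square A B \<psi>))"

section \<open>The constructions are bimodules\<close>

lemma abelian_group_cong: "abelian_group R \<Longrightarrow> carrier S = carrier R \<Longrightarrow> ring.zero S = ring.zero R \<Longrightarrow> ring.add S = ring.add R \<Longrightarrow> abelian_group S"
proof -
  assume a: "abelian_group R" "carrier S = carrier R" "ring.zero S = ring.zero R" "ring.add S = ring.add R"
  interpret R: abelian_group R by fact
  show ?thesis
    apply (rule abelian_groupI; unfold a)
    apply (simp_all add: R.a_ac)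
    done
qed

lemma bimodule_regular: assumes "ring R" shows "bimodule R R (regular_bimodule R)"
proof -
  interpret ring R by fact
  have "abelian_group (regular_bimodule R)"
    by (rule abelian_group_cong[of R]) (simp_all add: is_abelian_group regular_bimodule_def)
  then show ?thesis
    by (intro bimodule.intro bimodule_axioms.intro ring_axioms) (auto simp: regular_bimodule_def l_distr r_distr m_assoc)
qed

lemma bimodule_restrict: assumes "bimodule P Q M" "ring R" "ring S" "f \<in> ring_hom R P" "g \<in> ring_hom S Q"
  shows "bimodule R S (restrict_scalars f g M)"
proof -
  interpret bimodule P Q M by fact
  have "abelian_group (restrict_scalars f g M)"
    by (rule abelian_group_cong[of M]) (simp_all add: abelian_group_axioms restrict_scalars_def)
  then show ?thesis using assms
    by (intro bimodule.intro bimodule_axioms.intro assms)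
     (simp_all add: restrict_scalars_def ring_hom_closed ring_hom_add ring_hom_mult ring_hom_one lsmult_closed rsmult_closed
       lsmult_add rsmult_add add_lsmult add_rsmult mult_lsmult mult_rsmult one_lsmult one_rsmult lsmult_rsmult)
qed

lemma bimodule_power: assumes "bimodule R S M" shows "bimodule R S (power_bimodule M N)"
proof -
  interpret bimodule R S M by fact
  have "abelian_group (power_bimodule M N)"
    apply (rule abelian_groupI)
    apply (auto simp: power_bimodule_def fun_eq_iff PiE_iff)
    subgoal by (simp add: a_assoc)
    subgoal by (simp add: a_comm)
    subgoal for x by (simp add: extensional_def)
    subgoal for x by (simp add: extensional_def)
    subgoal for x by (rule bexI[of _ "\<lambda>i\<in>{1..N}. \<ominus>\<^bsub>M\<^esub> (x i)"]) (auto simp: l_neg)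
    done
  moreover have "v = (\<lambda>i\<in>{1..N}. v i)" if "v \<in> {1..N} \<rightarrow>\<^sub>E carrier M" for v
    using that by (simp add: PiE_restrict)
  ultimately show ?thesis
    apply (intro bimodule.intro bimodule_axioms.intro R.ring_axioms S.ring_axioms)
    apply (simp_all add: power_bimodule_def PiE_mem lsmult_closed rsmult_closed
       lsmult_add rsmult_add add_lsmult add_rsmult mult_lsmult mult_rsmult one_lsmult one_rsmult lsmult_rsmult PiE_iff)
    apply (auto simp: fun_eq_iff PiE_mem lsmult_closed rsmult_closed
       lsmult_add rsmult_add add_lsmult add_rsmult mult_lsmult mult_rsmult one_lsmult one_rsmult lsmult_rsmult PiE_iff)
    apply (simp_all add: extensional_def)
    done
qed

locale tensor_product = M: bimodule R B M + N: bimodule B S N for R B S M N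
begin
abbreviation "F \<equiv> tensor_free M N"
abbreviation "K \<equiv> tensor_relations M B N"
abbreviation "T \<equiv> tensor_bimodule M B N"
abbreviation "X \<equiv> carrier M \<times> carrier N"
definition "G = ({frag_of (x \<oplus>\<^bsub>M\<^esub> x', y) - frag_of (x, y) - frag_of (x', y) | x x' y.
        x \<in> carrier M \<and> x' \<in> carrier M \<and> y \<in> carrier N} \<union>
     {frag_of (x, y \<oplus>\<^bsub>N\<^esub> y') - frag_of (x, y) - frag_of (x, y') | x y y'.
        x \<in> carrier M \<and> y \<in> carrier N \<and> y' \<in> carrier N} \<union>
     {frag_of (rsmult M x b, y) - frag_of (x, lsmult N b y) | x b y.
        x \<in> carrier M \<and> b \<in> carrier B \<and> y \<in> carrier N})"
lemma K: "K = generate F G" unfolding tensor_relations_def G_def ..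
interpretation F: comm_group F by (rule abelian_free_Abelian_group)
lemma cF: "carrier F = {c. Poly_Mapping.keys c \<subseteq> X}" and mF: "monoid.mult F = (+)" and oF: "monoid.one F = 0"
  by (simp_all add: free_Abelian_group_def)
lemma minusF: "a \<in> carrier F \<Longrightarrow> b \<in> carrier F \<Longrightarrow> a - b \<in> carrier F"
  using keys_diff[of a b] by (auto simp: cF)
lemma plusF: "a \<in> carrier F \<Longrightarrow> b \<in> carrier F \<Longrightarrow> a + b \<in> carrier F"
  using F.m_closed[of a b] by (simp add: mF)
lemma ofF[simp]: "frag_of p \<in> carrier F \<longleftrightarrow> p \<in> X" by (simp add: cF)
lemma zF: "0 \<in> carrier F" by (simp add: cF)
lemma GF: "G \<subseteq> carrier F"
  unfolding G_def by (auto intro!: minusF simp: M.rsmult_closed N.lsmult_closed)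
lemma Ksub: "subgroup K F" unfolding K using F.generate_is_subgroup[OF GF] .
lemma KF: "K \<subseteq> carrier F" using Ksub subgroup.subset by blast
lemma K0: "0 \<in> K" using subgroup.one_closed[OF Ksub] by (simp add: oF)
lemma Kplus: "a \<in> K \<Longrightarrow> b \<in> K \<Longrightarrow> a + b \<in> K" using subgroup.m_closed[OF Ksub] by (simp add: mF)
lemma invF: "a \<in> carrier F \<Longrightarrow> inv\<^bsub>F\<^esub> a = - a"
  by (rule F.inv_equality) (auto simp: mF oF cF)
lemma Kneg: "a \<in> K \<Longrightarrow> - a \<in> K" using subgroup.m_inv_closed[OF Ksub, of a] KF invF by auto
lemma Kminus: "a \<in> K \<Longrightarrow> b \<in> K \<Longrightarrow> a - b \<in> K" using Kplus[OF _ Kneg] by fastforce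
lemma cos_eq: "c - d \<in> K \<Longrightarrow> K #>\<^bsub>F\<^esub> c = K #>\<^bsub>F\<^esub> d"
proof -
  assume a: "c - d \<in> K"
  have "\<exists>h\<in>K. k + c = h + d" if "k \<in> K" for k by (rule bexI[of _ "k + (c - d)"]) (use Kplus[OF that a] in auto)
  moreover have "\<exists>h\<in>K. k + d = h + c" if "k \<in> K" for k by (rule bexI[of _ "k - (c - d)"]) (use Kminus[OF that a] in auto)
  ultimately show ?thesis unfolding r_coset_def mF by blast
qed
lemma Gmap: assumes "\<And>c d. f (c + d) = f c + f d" "\<And>g. g \<in> G \<Longrightarrow> f g \<in> K" "k \<in> K" shows "(f k :: _ \<Rightarrow>\<^sub>0 int) \<in> K"
proof -
  have f0: "f 0 = 0" using assms(1)[of 0 0] by simp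
  have fn: "f (- c) = - f c" for c using assms(1)[of c "-c"] f0 by (simp add: eq_neg_iff_add_eq_0 add.commute)
  show ?thesis using assms(3) unfolding K
  proof (induction rule: generate.induct)
    case one then show ?case using f0 K0 by (simp add: oF K)
  next case (incl h) then show ?case using assms(2) K by simp
  next case (inv h) then show ?case using assms(2)[of h] K invF[of h] GF fn Kneg by auto
  next case (eng h1 h2) then show ?case using assms(1) Kplus K by (simp add: mF)
  qed
qed
lemma gens: "x \<in> carrier M \<Longrightarrow> x' \<in> carrier M \<Longrightarrow> y \<in> carrier N \<Longrightarrow> frag_of (x \<oplus>\<^bsub>M\<^esub> x', y) - frag_of (x, y) - frag_of (x', y) \<in> K"
 "x \<in> carrier M \<Longrightarrow> y' \<in> carrier N \<Longrightarrow> y \<in> carrier N \<Longrightarrow> frag_of (x, y \<oplus>\<^bsub>N\<^esub> y') - frag_of (x, y) - frag_of (x, y') \<in> K"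
 "x \<in> carrier M \<Longrightarrow> b \<in> carrier B \<Longrightarrow> y \<in> carrier N \<Longrightarrow> frag_of (rsmult M x b, y) - frag_of (x, lsmult N b y) \<in> K"
  unfolding K by (rule generate.incl, force simp: G_def)+

definition "L r = frag_extend (\<lambda>(x, y). frag_of (lsmult M r x, y))"
definition "Rr s = frag_extend (\<lambda>(x, y). frag_of (x, rsmult N y s))"
lemma Ladd: "L r (c+d) = L r c + L r d" "Rr s (c+d) = Rr s c + Rr s d" by (simp_all add: L_def Rr_def frag_extend_add)
lemma Ldiff: "L r (c-d) = L r c - L r d" "Rr s (c-d) = Rr s c - Rr s d" by (simp_all add: L_def Rr_def frag_extend_diff)
lemma L0: "L r 0 = 0" "Rr s 0 = 0" by (simp_all add: L_def Rr_def)
lemma Lof: "L r (frag_of (x,y)) = frag_of (lsmult M r x, y)" "Rr s (frag_of (x,y)) = frag_of (x, rsmult N y s)" by (simp_all add: L_def Rr_def)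
lemma LG: "r \<in> carrier R \<Longrightarrow> g \<in> G \<Longrightarrow> L r g \<in> K"
  unfolding G_def by (auto simp: Ldiff Lof M.lsmult_add M.lsmult_rsmult[symmetric] intro!: gens M.lsmult_closed)
lemma RG: "r \<in> carrier S \<Longrightarrow> g \<in> G \<Longrightarrow> Rr r g \<in> K"
  unfolding G_def by (auto simp: Ldiff Lof N.rsmult_add N.lsmult_rsmult intro!: gens N.rsmult_closed)
lemma LK: "r \<in> carrier R \<Longrightarrow> g \<in> K \<Longrightarrow> L r g \<in> K" by (rule Gmap[of "L r", OF Ladd(1) LG])
lemma RK: "r \<in> carrier S \<Longrightarrow> g \<in> K \<Longrightarrow> Rr r g \<in> K" by (rule Gmap[of "Rr r", OF Ladd(2) RG])
lemma cosmem: "d \<in> K #>\<^bsub>F\<^esub> c \<Longrightarrow> d - c \<in> K" by (auto simp: r_coset_def mF)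
lemma lT: "r \<in> carrier R \<Longrightarrow> lsmult T r (K #>\<^bsub>F\<^esub> c) = K #>\<^bsub>F\<^esub> L r c"
proof -
  assume r: "r \<in> carrier R"
  have "K #>\<^bsub>F\<^esub> L r d = K #>\<^bsub>F\<^esub> L r c" if "d \<in> K #>\<^bsub>F\<^esub> c" for d
    by (rule cos_eq) (use LK[OF r cosmem[OF that]] in \<open>simp add: Ldiff\<close>)
  note a = this
  have n: "K #>\<^bsub>F\<^esub> c \<noteq> {}" using K0 by (auto simp: r_coset_def)
  have "lsmult T r (K #>\<^bsub>F\<^esub> c) = (\<Union>d\<in>K #>\<^bsub>F\<^esub> c. K #>\<^bsub>F\<^esub> L r d)" unfolding tensor_bimodule_def L_def by simp
  also have "\<dots> = (\<Union>d\<in>K #>\<^bsub>F\<^esub> c. K #>\<^bsub>F\<^esub> L r c)" by (rule SUP_cong[OF refl a])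
  also have "\<dots> = K #>\<^bsub>F\<^esub> L r c" by (rule SUP_const[OF n])
  finally show ?thesis .
qed
lemma rT: "r \<in> carrier S \<Longrightarrow> rsmult T (K #>\<^bsub>F\<^esub> c) r = K #>\<^bsub>F\<^esub> Rr r c"
proof -
  assume r: "r \<in> carrier S"
  have "K #>\<^bsub>F\<^esub> Rr r d = K #>\<^bsub>F\<^esub> Rr r c" if "d \<in> K #>\<^bsub>F\<^esub> c" for d
    by (rule cos_eq) (use RK[OF r cosmem[OF that]] in \<open>simp add: Ldiff\<close>)
  note a = this
  have n: "K #>\<^bsub>F\<^esub> c \<noteq> {}" using K0 by (auto simp: r_coset_def)
  have "rsmult T (K #>\<^bsub>F\<^esub> c) r = (\<Union>d\<in>K #>\<^bsub>F\<^esub> c. K #>\<^bsub>F\<^esub> Rr r d)" unfolding tensor_bimodule_def Rr_def by simp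
  also have "\<dots> = (\<Union>d\<in>K #>\<^bsub>F\<^esub> c. K #>\<^bsub>F\<^esub> Rr r c)" by (rule SUP_cong[OF refl a])
  also have "\<dots> = K #>\<^bsub>F\<^esub> Rr r c" by (rule SUP_const[OF n])
  finally show ?thesis .
qed
lemma Find: assumes "c \<in> carrier F" "\<And>x y. x \<in> carrier M \<Longrightarrow> y \<in> carrier N \<Longrightarrow> f (frag_of (x,y)) \<in> H" "\<And>c d. f (c - d) = f c - f d"
   "0 \<in> H" "\<And>a b. a \<in> H \<Longrightarrow> b \<in> H \<Longrightarrow> a - b \<in> H"
  shows "(f c :: _ \<Rightarrow>\<^sub>0 int) \<in> H"
proof -
  have f0: "f 0 = 0" using assms(3)[of 0 0] by simp
  have k: "Poly_Mapping.keys c \<subseteq> X" using assms(1) by (simp add: cF)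
  show ?thesis
    apply (rule frag_induction[of c X "\<lambda>c. f c \<in> H", OF k])
    subgoal unfolding f0 by (rule assms(4))
    subgoal for x using assms(2)[of "fst x" "snd x"] by (cases x) simp
    subgoal for a b unfolding assms(3) by (rule assms(5))
    done
qed
lemma LF: "r \<in> carrier R \<Longrightarrow> c \<in> carrier F \<Longrightarrow> L r c \<in> carrier F"
  by (rule Find[where f="L r"]) (auto simp: Lof Ldiff M.lsmult_closed minusF zF simp del: carrier_free_Abelian_group_iff)
lemma RF: "r \<in> carrier S \<Longrightarrow> c \<in> carrier F \<Longrightarrow> Rr r c \<in> carrier F"
  by (rule Find[where f="Rr r"]) (auto simp: Lof Ldiff N.rsmult_closed minusF zF simp del: carrier_free_Abelian_group_iff)
lemma Kn: "K \<lhd> F" using F.subgroup_imp_normal[OF Ksub] .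
lemma cT: "carrier T = (\<lambda>c. K #>\<^bsub>F\<^esub> c) ` carrier F"
  by (simp add: tensor_bimodule_def carrier_FactGroup)
lemma aT: "c \<in> carrier F \<Longrightarrow> d \<in> carrier F \<Longrightarrow> (K #>\<^bsub>F\<^esub> c) \<oplus>\<^bsub>T\<^esub> (K #>\<^bsub>F\<^esub> d) = K #>\<^bsub>F\<^esub> (c + d)"
  using normal.rcos_sum[OF Kn, of c d] by (simp add: tensor_bimodule_def mF)
lemma agT: "abelian_group T"
proof -
  have "comm_group (F Mod K)" by (rule F.abelian_FactGroup[OF Ksub])
  then interpret Q: comm_group "F Mod K" .
  have e: "carrier T = carrier (F Mod K)" "ring.add T = monoid.mult (F Mod K)" "ring.zero T = one (F Mod K)" by (simp_all add: tensor_bimodule_def)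
  show ?thesis
    by (rule abelian_groupI; unfold e; (rule Q.m_closed Q.m_assoc Q.m_comm Q.l_one Q.one_closed Q.l_inv_ex; assumption)?)
qed

theorem bimodule_tensor: "bimodule R S T"
proof -
  have g: "f c \<in> K" if "c \<in> carrier F" "\<And>x y. x \<in> carrier M \<Longrightarrow> y \<in> carrier N \<Longrightarrow> f (frag_of (x,y)) \<in> K" "\<And>c d. f (c - d) = f c - f d" for f c
    using Find[OF that K0 Kminus] .
  note [simp del] = carrier_free_Abelian_group_iff
  have P1: "L (r \<oplus>\<^bsub>R\<^esub> r') c - (L r c + L r' c) \<in> K" if "c \<in> carrier F" "r \<in> carrier R" "r' \<in> carrier R" for r r' c
    by (rule g[where ?f2="\<lambda>c. L (r \<oplus>\<^bsub>R\<^esub> r') c - (L r c + L r' c)", OF that(1)]) (use that in \<open>auto simp: Lof Ldiff M.add_lsmult diff_diff_eq[symmetric] M.lsmult_closed gens\<close>)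
  have P2: "Rr (r \<oplus>\<^bsub>S\<^esub> r') c - (Rr r c + Rr r' c) \<in> K" if "c \<in> carrier F" "r \<in> carrier S" "r' \<in> carrier S" for r r' c
    by (rule g[where ?f2="\<lambda>c. Rr (r \<oplus>\<^bsub>S\<^esub> r') c - (Rr r c + Rr r' c)", OF that(1)]) (use that in \<open>auto simp: Lof Ldiff N.add_rsmult diff_diff_eq[symmetric] N.rsmult_closed gens\<close>)
  have P3: "L (r \<otimes>\<^bsub>R\<^esub> r') c - L r (L r' c) \<in> K" if "c \<in> carrier F" "r \<in> carrier R" "r' \<in> carrier R" for r r' c
    by (rule g[where ?f2="\<lambda>c. L (r \<otimes>\<^bsub>R\<^esub> r') c - L r (L r' c)", OF that(1)]) (use that in \<open>auto simp: Lof Ldiff M.mult_lsmult K0\<close>)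
  have P4: "Rr (r \<otimes>\<^bsub>S\<^esub> r') c - Rr r' (Rr r c) \<in> K" if "c \<in> carrier F" "r \<in> carrier S" "r' \<in> carrier S" for r r' c
    by (rule g[where ?f2="\<lambda>c. Rr (r \<otimes>\<^bsub>S\<^esub> r') c - Rr r' (Rr r c)", OF that(1)]) (use that in \<open>auto simp: Lof Ldiff N.mult_rsmult K0\<close>)
  have P5: "L \<one>\<^bsub>R\<^esub> c - c \<in> K" "Rr \<one>\<^bsub>S\<^esub> c - c \<in> K" if "c \<in> carrier F" for c
    by (rule g[where ?f2="\<lambda>c. L \<one>\<^bsub>R\<^esub> c - c", OF that(1)]; simp add: Lof Ldiff M.one_lsmult N.one_rsmult K0)
       (rule g[where ?f2="\<lambda>c. Rr \<one>\<^bsub>S\<^esub> c - c", OF that(1)]; simp add: Lof Ldiff M.one_lsmult N.one_rsmult K0)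
  have P6: "Rr s (L r c) - L r (Rr s c) \<in> K" if "c \<in> carrier F" for r s c
    by (rule g[where ?f2="\<lambda>c. Rr s (L r c) - L r (Rr s c)", OF that(1)]) (use that in \<open>auto simp: Lof Ldiff K0\<close>)
  show ?thesis
    apply (intro bimodule.intro bimodule_axioms.intro M.R.ring_axioms N.S.ring_axioms agT)
    by (auto simp: cT aT lT rT LF RF plusF Ladd cos_eq[OF P1] cos_eq[OF P2] cos_eq[OF P3] cos_eq[OF P4] cos_eq[OF P5(1)] cos_eq[OF P5(2)] cos_eq[OF P6] intro!: imageI)
qed
lemma tensor_elem_props:
  assumes "x \<in> carrier M" "y \<in> carrier N"
  shows "tensor_elem M B N x y \<in> carrier T"
   "r \<in> carrier R \<Longrightarrow> lsmult T r (tensor_elem M B N x y) = tensor_elem M B N (lsmult M r x) y"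
   "s \<in> carrier S \<Longrightarrow> rsmult T (tensor_elem M B N x y) s = tensor_elem M B N x (rsmult N y s)"
   "b \<in> carrier B \<Longrightarrow> tensor_elem M B N (rsmult M x b) y = tensor_elem M B N x (lsmult N b y)"
   "x' \<in> carrier M \<Longrightarrow> tensor_elem M B N (x \<oplus>\<^bsub>M\<^esub> x') y = tensor_elem M B N x y \<oplus>\<^bsub>T\<^esub> tensor_elem M B N x' y"
   "y' \<in> carrier N \<Longrightarrow> tensor_elem M B N x (y \<oplus>\<^bsub>N\<^esub> y') = tensor_elem M B N x y \<oplus>\<^bsub>T\<^esub> tensor_elem M B N x y'"
proof -
  note [simp del] = carrier_free_Abelian_group_iff
  note d = tensor_elem_def
  show "tensor_elem M B N x y \<in> carrier T" using assms by (simp add: d cT)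
  show "r \<in> carrier R \<Longrightarrow> lsmult T r (tensor_elem M B N x y) = tensor_elem M B N (lsmult M r x) y" by (simp add: d lT Lof)
  show "s \<in> carrier S \<Longrightarrow> rsmult T (tensor_elem M B N x y) s = tensor_elem M B N x (rsmult N y s)" by (simp add: d rT Lof)
  show "b \<in> carrier B \<Longrightarrow> tensor_elem M B N (rsmult M x b) y = tensor_elem M B N x (lsmult N b y)"
    unfolding d by (rule cos_eq) (simp add: gens assms)
  show "x' \<in> carrier M \<Longrightarrow> tensor_elem M B N (x \<oplus>\<^bsub>M\<^esub> x') y = tensor_elem M B N x y \<oplus>\<^bsub>T\<^esub> tensor_elem M B N x' y"
    using assms by (simp add: d aT) (rule cos_eq, simp add: gens diff_diff_eq[symmetric])
  show "y' \<in> carrier N \<Longrightarrow> tensor_elem M B N x (y \<oplus>\<^bsub>N\<^esub> y') = tensor_elem M B N x y \<oplus>\<^bsub>T\<^esub> tensor_elem M B N x y'"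
    using assms by (simp add: d aT) (rule cos_eq, simp add: gens diff_diff_eq[symmetric])
qed
end

end

theory Submission
  imports Defs
begin

text \<open>Right depth three means that \<open>A \<otimes>\<^sub>B A\<close> is a retract of \<open>A\<^sup>N\<close>: there are \<open>A\<close>-\<open>C\<close>-bimodule homomorphisms
  \<open>g : A \<otimes>\<^sub>B A \<rightarrow> A\<^sup>N\<close> and \<open>f : A\<^sup>N \<rightarrow> A \<otimes>\<^sub>B A\<close> with \<open>f \<circ> g = id\<close>. Such a \<open>g\<close> has the form
  \<open>x \<otimes> y \<mapsto> (x \<gamma>\<^sub>i(y))\<^sub>i\<close> with \<open>\<gamma>\<^sub>i(y) = g(1 \<otimes> y)\<^sub>i\<close> a \<open>B\<close>-\<open>C\<close>-endomorphism of \<open>A\<close>, and such an \<open>f\<close> has the form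
  \<open>v \<mapsto> \<Sum> v\<^sub>i u\<^sub>i\<close> with \<open>u\<^sub>i = f(e\<^sub>i)\<close> centralizing \<open>C\<close>. Evaluating \<open>f \<circ> g = id\<close> on pure tensors gives the
  equation of the theorem.\<close>

text \<open>Makes \<open>A \<otimes>\<^sub>B A\<close> with right scalars restricted to \<open>C\<close> itself a tensor product of bimodules,
  so that the universal property yields \<open>A\<close>-\<open>C\<close>-bimodule homomorphisms directly.\<close>

lemma restrict_scalars_tensor:
  "restrict_scalars f g (tensor_bimodule M B N) =
    tensor_bimodule (restrict_scalars f id M) B (restrict_scalars id g N)"
  by (simp add: tensor_bimodule_def restrict_scalars_def tensor_relations_def)

lemma finsum_restrict_scalars [simp]: "finsum (restrict_scalars f g M) h I = finsum M h I"
  by (simp add: finsum_def finprod_def restrict_scalars_def)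

section \<open>Homomorphisms of bimodules and of their additive groups\<close>

lemma bimodule_homI:
  assumes "h \<in> carrier M \<rightarrow> carrier N"
    and "\<And>x y. \<lbrakk>x \<in> carrier M; y \<in> carrier M\<rbrakk> \<Longrightarrow> h (x \<oplus>\<^bsub>M\<^esub> y) = h x \<oplus>\<^bsub>N\<^esub> h y"
    and "\<And>r x. \<lbrakk>r \<in> carrier R; x \<in> carrier M\<rbrakk> \<Longrightarrow> h (lsmult M r x) = lsmult N r (h x)"
    and "\<And>s x. \<lbrakk>s \<in> carrier S; x \<in> carrier M\<rbrakk> \<Longrightarrow> h (rsmult M x s) = rsmult N (h x) s"
  shows "h \<in> bimodule_hom R S M N"
  using assms by (simp add: bimodule_hom_def)

lemma bimodule_homD:
  assumes "h \<in> bimodule_hom R S M N"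
  shows "x \<in> carrier M \<Longrightarrow> h x \<in> carrier N"
    and "\<lbrakk>x \<in> carrier M; y \<in> carrier M\<rbrakk> \<Longrightarrow> h (x \<oplus>\<^bsub>M\<^esub> y) = h x \<oplus>\<^bsub>N\<^esub> h y"
    and "\<lbrakk>r \<in> carrier R; x \<in> carrier M\<rbrakk> \<Longrightarrow> h (lsmult M r x) = lsmult N r (h x)"
    and "\<lbrakk>s \<in> carrier S; x \<in> carrier M\<rbrakk> \<Longrightarrow> h (rsmult M x s) = rsmult N (h x) s"
  using assms by (auto simp: bimodule_hom_def)

lemma bimodule_hom_abelian_group_hom:
  assumes "abelian_group M" "abelian_group N" "h \<in> bimodule_hom R S M N"
  shows "abelian_group_hom M N h"
proof -
  have "h \<in> hom (add_monoid M) (add_monoid N)"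
    using bimodule_homD[OF assms(3)] by (auto simp: hom_def)
  then show ?thesis
    using assms(1,2)
    by (intro abelian_group_homI group_hom.intro group_hom_axioms.intro)
      (auto simp: abelian_group.a_group)
qed

lemma (in abelian_group_hom) hom_finsum:
  assumes "finite I" "f \<in> I \<rightarrow> carrier G"
  shows "h (\<Oplus>\<^bsub>G\<^esub>i\<in>I. f i) = (\<Oplus>\<^bsub>H\<^esub>i\<in>I. h (f i))"
  using assms
  by (induction I) (auto simp: G.finsum_insert H.finsum_insert G.finsum_empty H.finsum_empty Pi_iff G.finsum_closed)

section \<open>Direct summands as retracts\<close>

text \<open>An isomorphism \<open>h\<close> onto a summand \<open>P\<close> with complement
  \<open>Q\<close> is itself the section, and the retraction is the projection along
  \<open>Q\<close> followed by the inverse of \<open>h\<close>. Conversely, a section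
  \<open>g\<close> with retraction \<open>f\<close> splits \<open>N\<close> into the image of
  \<open>g\<close> and the kernel of \<open>f\<close>. This replaces the existential over submodules
  by a condition on two homomorphisms.\<close>

lemma direct_summand_iso_iff_retract:
  assumes "bimodule R S M" "bimodule R S N"
  shows "(\<exists>P. direct_summand R S P N \<and> bimodule_iso R S M (N\<lparr>carrier := P\<rparr>) \<noteq> {}) \<longleftrightarrow>
    (\<exists>g\<in>bimodule_hom R S M N. \<exists>f\<in>bimodule_hom R S N M. \<forall>x\<in>carrier M. f (g x) = x)"
    (is "?summand \<longleftrightarrow> ?retract")
proof
  interpret M: bimodule R S M by fact
  interpret N: bimodule R S N by fact
  assume ?summand
  then obtain P Q h where P: "subbimodule R S P N" and Q: "subbimodule R S Q N"
    and PQ: "P \<inter> Q = {\<zero>\<^bsub>N\<^esub>}" "P <+>\<^bsub>N\<^esub> Q = carrier N"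
    and h: "h \<in> bimodule_hom R S M (N\<lparr>carrier := P\<rparr>)" "bij_betw h (carrier M) P"
    by (auto simp: direct_summand_def bimodule_iso_def)
  interpret P: additive_subgroup P N using P by (simp add: subbimodule_def)
  interpret Q: additive_subgroup Q N using Q by (simp add: subbimodule_def)
  note hD = bimodule_homD[OF h(1), simplified]
  have hN: "h \<in> bimodule_hom R S M N"
    using h(1) P.a_subset by (auto simp: bimodule_hom_def)
  \<comment> \<open>The projection of \<open>n\<close> along \<open>Q\<close>, pulled back through
    \<open>h\<close>. Existence of the described \<open>x\<close> comes from \<open>P\<close> and
    \<open>Q\<close> spanning \<open>N\<close> (\<open>decomp\<close>), uniqueness from their
    trivial intersection together with injectivity of \<open>h\<close>
    (\<open>f_eq\<close>).\<close>
  define f where "f n = (THE x. x \<in> carrier M \<and> (\<exists>q\<in>Q. n = h x \<oplus>\<^bsub>N\<^esub> q))" for n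
  have f_eq: "f (h x \<oplus>\<^bsub>N\<^esub> q) = x" if x: "x \<in> carrier M" and q: "q \<in> Q" for x q
    unfolding f_def
  proof (rule the_equality)
    show "x \<in> carrier M \<and> (\<exists>q'\<in>Q. h x \<oplus>\<^bsub>N\<^esub> q = h x \<oplus>\<^bsub>N\<^esub> q')"
      using that by blast
  next
    fix x' assume "x' \<in> carrier M \<and> (\<exists>q'\<in>Q. h x \<oplus>\<^bsub>N\<^esub> q = h x' \<oplus>\<^bsub>N\<^esub> q')"
    then obtain q' where x': "x' \<in> carrier M" and q': "q' \<in> Q"
      and eq: "h x \<oplus>\<^bsub>N\<^esub> q = h x' \<oplus>\<^bsub>N\<^esub> q'" by blast
    have car: "h x \<in> carrier N" "h x' \<in> carrier N" "q \<in> carrier N" "q' \<in> carrier N"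
      using hD(1) x x' q q' P.a_Hcarr Q.a_Hcarr by auto
    \<comment> \<open>The difference of two decompositions of one element lies in both
      \<open>P\<close> and \<open>Q\<close>, hence vanishes.\<close>
    have "h x \<ominus>\<^bsub>N\<^esub> h x' = q' \<ominus>\<^bsub>N\<^esub> q"
      using eq car by (smt (verit) N.a_comm N.add.inv_closed N.add.inv_solve_right N.a_assoc N.minus_eq N.add.m_closed)
    moreover have "h x \<ominus>\<^bsub>N\<^esub> h x' \<in> P" "q' \<ominus>\<^bsub>N\<^esub> q \<in> Q"
      using hD(1) x x' q q' by (auto simp: N.minus_eq P.a_inv_closed Q.a_inv_closed)
    ultimately have "h x \<ominus>\<^bsub>N\<^esub> h x' = \<zero>\<^bsub>N\<^esub>"
      using PQ(1) by auto
    then have "h x = h x'"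
      using car by (simp add: N.minus_eq) (metis N.add.inv_closed N.add.inv_equality N.minus_minus)
    then show "x' = x"
      using h(2) x x' by (auto simp: bij_betw_def inj_on_def)
  qed
  have decomp: "\<exists>x\<in>carrier M. \<exists>q\<in>Q. n = h x \<oplus>\<^bsub>N\<^esub> q" if "n \<in> carrier N" for n
  proof -
    have "n \<in> P <+>\<^bsub>N\<^esub> Q" using that PQ(2) by simp
    then obtain p q where "p \<in> P" "q \<in> Q" "n = p \<oplus>\<^bsub>N\<^esub> q"
      by (auto simp: set_add_def')
    then show ?thesis using h(2) by (auto simp: bij_betw_def)
  qed
  have "f \<in> bimodule_hom R S N M"
  proof (rule bimodule_homI)
    show "f \<in> carrier N \<rightarrow> carrier M"
      using decomp f_eq by fastforce
  next
    fix m n assume "m \<in> carrier N" "n \<in> carrier N"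
    then obtain x y p q where *: "x \<in> carrier M" "y \<in> carrier M" "p \<in> Q" "q \<in> Q"
      "m = h x \<oplus>\<^bsub>N\<^esub> p" "n = h y \<oplus>\<^bsub>N\<^esub> q" using decomp by meson
    then have "m \<oplus>\<^bsub>N\<^esub> n = h (x \<oplus>\<^bsub>M\<^esub> y) \<oplus>\<^bsub>N\<^esub> (p \<oplus>\<^bsub>N\<^esub> q)"
      by (simp add: hD P.a_Hcarr Q.a_Hcarr N.a_ac)
    then show "f (m \<oplus>\<^bsub>N\<^esub> n) = f m \<oplus>\<^bsub>M\<^esub> f n" using * by (simp add: f_eq)
  next
    fix r n assume r: "r \<in> carrier R" and "n \<in> carrier N"
    then obtain x q where *: "x \<in> carrier M" "q \<in> Q" "n = h x \<oplus>\<^bsub>N\<^esub> q" using decomp by meson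
    then have "lsmult N r n = h (lsmult M r x) \<oplus>\<^bsub>N\<^esub> lsmult N r q"
      using r by (simp add: hD P.a_Hcarr Q.a_Hcarr N.lsmult_add)
    then show "f (lsmult N r n) = lsmult M r (f n)"
      using * r Q by (simp add: f_eq M.lsmult_closed subbimodule_def)
  next
    fix s n assume s: "s \<in> carrier S" and "n \<in> carrier N"
    then obtain x q where *: "x \<in> carrier M" "q \<in> Q" "n = h x \<oplus>\<^bsub>N\<^esub> q" using decomp by meson
    then have "rsmult N n s = h (rsmult M x s) \<oplus>\<^bsub>N\<^esub> rsmult N q s"
      using s by (simp add: hD P.a_Hcarr Q.a_Hcarr N.rsmult_add)
    then show "f (rsmult N n s) = rsmult M (f n) s"
      using * s Q by (simp add: f_eq M.rsmult_closed subbimodule_def)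
  qed
  moreover have "f (h x) = x" if "x \<in> carrier M" for x
    using f_eq[OF that Q.zero_closed] hD(1)[OF that] by (simp add: P.a_Hcarr)
  ultimately show ?retract using hN by blast
next
  interpret M: bimodule R S M by fact
  interpret N: bimodule R S N by fact
  assume ?retract
  then obtain g f where g: "g \<in> bimodule_hom R S M N" and f: "f \<in> bimodule_hom R S N M"
    and fg: "\<And>x. x \<in> carrier M \<Longrightarrow> f (g x) = x" by blast
  interpret g: abelian_group_hom M N g
    using g by (intro bimodule_hom_abelian_group_hom) unfold_locales
  interpret f: abelian_group_hom N M f
    using f by (intro bimodule_hom_abelian_group_hom) unfold_locales
  note gD = bimodule_homD[OF g] and fD = bimodule_homD[OF f]
  define P where "P = g ` carrier M"
  define Q where "Q = a_kernel N M f"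
  have Q_iff: "n \<in> Q \<longleftrightarrow> n \<in> carrier N \<and> f n = \<zero>\<^bsub>M\<^esub>" for n
    by (simp add: Q_def a_kernel_def')
  have "additive_subgroup P N"
    unfolding P_def using group_hom.img_is_subgroup[OF g.a_group_hom]
    by (simp add: additive_subgroup_def)
  then have P: "subbimodule R S P N"
    by (auto simp: subbimodule_def P_def gD(3,4)[symmetric] M.lsmult_closed M.rsmult_closed)
  \<comment> \<open>From r0 = r0 + r0. These zero laws make the kernel of \<open>f\<close> closed
    under both scalar actions.\<close>
  have [simp]: "lsmult M r \<zero>\<^bsub>M\<^esub> = \<zero>\<^bsub>M\<^esub>" if "r \<in> carrier R" for r
    using M.lsmult_add[OF that M.zero_closed M.zero_closed] M.lsmult_closed[OF that M.zero_closed]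
    by (simp add: M.add.l_cancel_one')
  have [simp]: "rsmult M \<zero>\<^bsub>M\<^esub> s = \<zero>\<^bsub>M\<^esub>" if "s \<in> carrier S" for s
    using M.rsmult_add[OF that M.zero_closed M.zero_closed] M.rsmult_closed[OF that M.zero_closed]
    by (simp add: M.add.l_cancel_one')
  have Q: "subbimodule R S Q N"
    using f.additive_subgroup_a_kernel
    by (auto simp: subbimodule_def Q_iff fD N.lsmult_closed N.rsmult_closed simp flip: Q_def)
  have "P \<inter> Q = {\<zero>\<^bsub>N\<^esub>}"
    by (auto simp: P_def Q_iff fg intro!: image_eqI[of _ g "\<zero>\<^bsub>M\<^esub>"])
  moreover have "P <+>\<^bsub>N\<^esub> Q = carrier N"
  proof
    show "P <+>\<^bsub>N\<^esub> Q \<subseteq> carrier N" by (auto simp: set_add_def' P_def Q_iff)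
  next
    show "carrier N \<subseteq> P <+>\<^bsub>N\<^esub> Q"
    proof
      fix n assume n: "n \<in> carrier N"
      \<comment> \<open>The second term lies in the kernel because f(g(f n)) = f n.\<close>
      have "n = g (f n) \<oplus>\<^bsub>N\<^esub> (n \<ominus>\<^bsub>N\<^esub> g (f n))"
        using n by (simp add: N.minus_eq N.a_lcomm N.r_neg)
      moreover have "n \<ominus>\<^bsub>N\<^esub> g (f n) \<in> Q"
        using n by (simp add: Q_iff N.minus_eq fg M.r_neg)
      ultimately show "n \<in> P <+>\<^bsub>N\<^esub> Q"
        using n by (auto simp: set_add_def' P_def)
    qed
  qed
  moreover have "g \<in> bimodule_iso R S M (N\<lparr>carrier := P\<rparr>)"
    using g by (auto simp: bimodule_iso_def bimodule_hom_def bij_betw_def P_def intro: inj_on_inverseI fg)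
  ultimately show ?summand
    using P Q by (auto simp: direct_summand_def)
qed

section \<open>The universal property of the tensor product\<close>

context tensor_product
begin

lemma tensor_bimodule_group: "carrier T = carrier (F Mod K)" "monoid.mult (F Mod K) = add T"
  by (simp_all add: tensor_bimodule_def)

text \<open>Pure tensors generate the tensor product as an abelian group: every element is the coset
  of an integer combination of pairs. Only additivity of the two maps is assumed, so the lemma also
  serves to prove that a map respects scalars.\<close>

lemma tensor_hom_ext:
  assumes f: "abelian_group_hom T H f" and g: "abelian_group_hom T H g"
    and eq: "\<And>x y. \<lbrakk>x \<in> carrier M; y \<in> carrier N\<rbrakk> \<Longrightarrow> f (tensor_elem M B N x y) = g (tensor_elem M B N x y)"
    and t: "t \<in> carrier T"
  shows "f t = g t"
proof -
  interpret f: abelian_group_hom T H f by fact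
  interpret g: abelian_group_hom T H g by fact
  let ?cos = "\<lambda>c. K #>\<^bsub>F\<^esub> c"
  have cos_closed: "?cos c \<in> carrier T" if "c \<in> carrier F" for c
    using that unfolding cT by blast
  \<comment> \<open>The induction principle for the free abelian group proceeds by differences, so
    passage to cosets has to be compatible with subtraction.\<close>
  have cos_diff: "?cos (a - b) = ?cos a \<oplus>\<^bsub>T\<^esub> (\<ominus>\<^bsub>T\<^esub> ?cos b)" if "a \<in> carrier F" "b \<in> carrier F" for a b
  proof -
    have "?cos (a - b) \<oplus>\<^bsub>T\<^esub> ?cos b = ?cos a"
      using aT[OF minusF[OF that] that(2)] by simp
    then show ?thesis
      using cos_closed that minusF[OF that]
      by (metis f.G.add.inv_solve_right)
  qed
  have "f (?cos c) = g (?cos c)" if "Poly_Mapping.keys c \<subseteq> X" for c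
  proof (rule free_Abelian_group_induct[OF that])
    \<comment> \<open>An idempotent of a group is its neutral element.\<close>
    have "?cos 0 \<oplus>\<^bsub>T\<^esub> ?cos 0 = ?cos 0"
      using aT[OF zF zF] by simp
    then have "?cos 0 = \<zero>\<^bsub>T\<^esub>"
      using cos_closed[OF zF] by (simp add: f.G.add.l_cancel_one')
    then show "f (?cos 0) = g (?cos 0)" by simp
  next
    fix a b assume "Poly_Mapping.keys a \<subseteq> X" "Poly_Mapping.keys b \<subseteq> X"
      and "f (?cos a) = g (?cos a)" "f (?cos b) = g (?cos b)"
    then show "f (?cos (a - b)) = g (?cos (a - b))"
      by (simp add: cos_diff cos_closed)
  next
    fix p assume "p \<in> X"
    then show "f (?cos (frag_of p)) = g (?cos (frag_of p))"
      using eq by (cases p) (auto simp: tensor_elem_def)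
  qed
  then show ?thesis
    using t unfolding cT by auto
qed

text \<open>The map \<open>f\<close> extends additively to the free abelian group on pairs.
  Biadditivity and balance put the relations into the kernel of this extension, which therefore
  factors through the quotient. The hypotheses \<open>left\<close> and \<open>right\<close> then
  make the induced map a bimodule homomorphism.\<close>

lemma tensor_bimodule_hom_lift:
  assumes H: "bimodule R S H"
    and closed: "\<And>x y. \<lbrakk>x \<in> carrier M; y \<in> carrier N\<rbrakk> \<Longrightarrow> f x y \<in> carrier H"
    and add_left: "\<And>x x' y. \<lbrakk>x \<in> carrier M; x' \<in> carrier M; y \<in> carrier N\<rbrakk>
      \<Longrightarrow> f (x \<oplus>\<^bsub>M\<^esub> x') y = f x y \<oplus>\<^bsub>H\<^esub> f x' y"
    and add_right: "\<And>x y y'. \<lbrakk>x \<in> carrier M; y \<in> carrier N; y' \<in> carrier N\<rbrakk>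
      \<Longrightarrow> f x (y \<oplus>\<^bsub>N\<^esub> y') = f x y \<oplus>\<^bsub>H\<^esub> f x y'"
    and balanced: "\<And>x b y. \<lbrakk>x \<in> carrier M; b \<in> carrier B; y \<in> carrier N\<rbrakk>
      \<Longrightarrow> f (rsmult M x b) y = f x (lsmult N b y)"
    and left: "\<And>r x y. \<lbrakk>r \<in> carrier R; x \<in> carrier M; y \<in> carrier N\<rbrakk>
      \<Longrightarrow> f (lsmult M r x) y = lsmult H r (f x y)"
    and right: "\<And>x y s. \<lbrakk>x \<in> carrier M; y \<in> carrier N; s \<in> carrier S\<rbrakk>
      \<Longrightarrow> f x (rsmult N y s) = rsmult H (f x y) s"
  obtains h where "h \<in> bimodule_hom R S T H"
    and "\<And>x y. \<lbrakk>x \<in> carrier M; y \<in> carrier N\<rbrakk> \<Longrightarrow> h (tensor_elem M B N x y) = f x y"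
proof -
  interpret H: bimodule R S H by fact
  interpret T: bimodule R S T by (rule bimodule_tensor)
  interpret F: comm_group F by (rule abelian_free_Abelian_group)
  have "(\<lambda>(x, y). f x y) ` X \<subseteq> carrier (add_monoid H)"
    using closed by auto
  then obtain k where k: "k \<in> hom F (add_monoid H)"
    and k_of: "\<And>p. p \<in> X \<Longrightarrow> k (frag_of p) = (case p of (x, y) \<Rightarrow> f x y)"
    by (rule comm_group.free_Abelian_group_universal[OF H.a_comm_group]) (rule that)
  interpret k: group_hom F "add_monoid H" k
    using k H.a_group by (simp add: group_hom_def group_hom_axioms_def F.is_group)
  \<comment> \<open>The generating relations are written with the subtraction of
    \<open>poly_mapping\<close>, whereas \<open>k\<close> is a homomorphism for the group operations
    of \<open>F\<close> and \<open>H\<close>; this translates between the two.\<close>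
  have k_diff: "k (c - d) = k c \<ominus>\<^bsub>H\<^esub> k d" if "c \<in> carrier F" "d \<in> carrier F" for c d
  proof -
    have "c - d = c \<otimes>\<^bsub>F\<^esub> inv\<^bsub>F\<^esub> d" using that invF[OF that(2)] by (simp add: mF)
    then show ?thesis
      using that k.hom_mult[of c "inv\<^bsub>F\<^esub> d"] k.hom_inv[OF that(2)]
      by (simp add: H.minus_eq a_inv_def del: carrier_free_Abelian_group_iff mult_free_Abelian_group inv_free_Abelian_group)
  qed
  note [simp del] = carrier_free_Abelian_group_iff
  \<comment> \<open>The shape that both kinds of biadditivity relation take under
    \<open>k\<close>.\<close>
  have cancel: "(a \<oplus>\<^bsub>H\<^esub> b) \<ominus>\<^bsub>H\<^esub> a \<ominus>\<^bsub>H\<^esub> b = \<zero>\<^bsub>H\<^esub>"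
    if "a \<in> carrier H" "b \<in> carrier H" for a b
    using that by (simp add: H.minus_eq H.a_comm H.a_assoc H.r_neg H.r_neg1 H.r_neg2 H.l_neg)
  \<comment> \<open>The kernel is a subgroup, so it suffices to check the generators
    \<open>G\<close> of \<open>K\<close>.\<close>
  have "K \<subseteq> kernel F (add_monoid H) k"
    unfolding K
  proof (rule F.generate_subgroup_incl[OF _ k.subgroup_kernel])
    show "G \<subseteq> kernel F (add_monoid H) k"
      unfolding G_def kernel_def
      by (auto simp: k_diff k_of minusF M.rsmult_closed N.lsmult_closed closed add_left add_right balanced cancel H.minus_eq[of "f _ _" "f _ _"] H.r_neg)
  qed
  from k.FactGroup_universal_kernel[OF Kn this]
  obtain h where h: "h \<in> hom (F Mod K) (add_monoid H)"
    and h_cos: "\<And>c. c \<in> carrier F \<Longrightarrow> h (K #>\<^bsub>F\<^esub> c) = k c" by blast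
  have h_tensor: "h (tensor_elem M B N x y) = f x y" if "x \<in> carrier M" "y \<in> carrier N" for x y
    using that by (simp add: tensor_elem_def h_cos k_of)
  have h_closed: "h t \<in> carrier H" if "t \<in> carrier T" for t
    using h that by (auto simp: hom_def tensor_bimodule_group)
  have h_add: "h (t \<oplus>\<^bsub>T\<^esub> u) = h t \<oplus>\<^bsub>H\<^esub> h u" if "t \<in> carrier T" "u \<in> carrier T" for t u
    using h that by (simp add: hom_def tensor_bimodule_group del: mult_FactGroup)
  \<comment> \<open>For a fixed scalar, both sides of a linearity law are additive in
    \<open>t\<close>. With this, \<open>tensor_hom_ext\<close> reduces each law to pure tensors,
    where it is \<open>left\<close> or \<open>right\<close>.\<close>
  have homI: "abelian_group_hom T H p"
    if "\<And>t. t \<in> carrier T \<Longrightarrow> p t \<in> carrier H"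
      "\<And>t u. \<lbrakk>t \<in> carrier T; u \<in> carrier T\<rbrakk> \<Longrightarrow> p (t \<oplus>\<^bsub>T\<^esub> u) = p t \<oplus>\<^bsub>H\<^esub> p u" for p
    using that
    by (intro abelian_group_homI T.abelian_group_axioms H.abelian_group_axioms group_hom.intro group_hom_axioms.intro
        T.a_group H.a_group) (auto simp: hom_def)
  have "h \<in> bimodule_hom R S T H"
  proof (rule bimodule_homI)
    fix r t assume r: "r \<in> carrier R" and t: "t \<in> carrier T"
    show "h (lsmult T r t) = lsmult H r (h t)"
    proof (rule tensor_hom_ext[OF _ _ _ t])
      show "abelian_group_hom T H (\<lambda>t. h (lsmult T r t))"
        using r by (intro homI) (simp_all add: h_closed h_add T.lsmult_closed T.lsmult_add)
      show "abelian_group_hom T H (\<lambda>t. lsmult H r (h t))"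
        using r by (intro homI) (simp_all add: h_closed h_add H.lsmult_closed H.lsmult_add)
    qed (simp add: r tensor_elem_props h_tensor left M.lsmult_closed)
  next
    fix s t assume s: "s \<in> carrier S" and t: "t \<in> carrier T"
    show "h (rsmult T t s) = rsmult H (h t) s"
    proof (rule tensor_hom_ext[OF _ _ _ t])
      show "abelian_group_hom T H (\<lambda>t. h (rsmult T t s))"
        using s by (intro homI) (simp_all add: h_closed h_add T.rsmult_closed T.rsmult_add)
      show "abelian_group_hom T H (\<lambda>t. rsmult H (h t) s)"
        using s by (intro homI) (simp_all add: h_closed h_add H.rsmult_closed H.rsmult_add)
    qed (simp add: s tensor_elem_props h_tensor right N.rsmult_closed)
  qed (simp_all add: h_closed h_add)
  then show thesis using that h_tensor by blast
qed

end

section \<open>Finite sums and homomorphisms out of the power A^N\<close>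

lemma (in bimodule) finsum_lsmult:
  assumes "r \<in> carrier R" "finite I" "f \<in> I \<rightarrow> carrier M"
  shows "lsmult M r (\<Oplus>i\<in>I. f i) = (\<Oplus>i\<in>I. lsmult M r (f i))"
proof -
  have "abelian_group_hom M M (lsmult M r)"
    using assms(1)
    by (intro abelian_group_homI abelian_group_axioms group_hom.intro group_hom_axioms.intro a_group)
      (auto simp: hom_def lsmult_closed lsmult_add)
  from abelian_group_hom.hom_finsum[OF this assms(2,3)] show ?thesis .
qed

lemma (in bimodule) finsum_rsmult:
  assumes "s \<in> carrier S" "finite I" "f \<in> I \<rightarrow> carrier M"
  shows "rsmult M (\<Oplus>i\<in>I. f i) s = (\<Oplus>i\<in>I. rsmult M (f i) s)"
proof -
  have "abelian_group_hom M M (\<lambda>x. rsmult M x s)"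
    using assms(1)
    by (intro abelian_group_homI abelian_group_axioms group_hom.intro group_hom_axioms.intro a_group)
      (auto simp: hom_def rsmult_closed rsmult_add)
  from abelian_group_hom.hom_finsum[OF this assms(2,3)] show ?thesis .
qed

text \<open>The restriction to \<open>{1..N}\<close> puts the vector into the extensional carrier of
  \<open>power_bimodule\<close>. An index \<open>i\<close> outside \<open>{1..N}\<close> gives the
  zero vector, so closure and centrality hold for every \<open>i\<close>.\<close>

definition power_basis :: "('a, 'x) ring_scheme \<Rightarrow> nat \<Rightarrow> nat \<Rightarrow> nat \<Rightarrow> 'a" where
  "power_basis A N i = (\<lambda>j\<in>{1..N}. if i = j then \<one>\<^bsub>A\<^esub> else \<zero>\<^bsub>A\<^esub>)"

lemma bimodule_restrict_regular:
  assumes "ring A" "ring R" "ring S" "f \<in> ring_hom R A" "g \<in> ring_hom S A"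
  shows "bimodule R S (restrict_scalars f g (regular_bimodule A))"
  using assms by (intro bimodule_restrict[OF bimodule_regular])

lemma restrict_regular_simps [simp]:
  "carrier (restrict_scalars f g (regular_bimodule A)) = carrier A"
  "\<zero>\<^bsub>restrict_scalars f g (regular_bimodule A)\<^esub> = \<zero>\<^bsub>A\<^esub>"
  "add (restrict_scalars f g (regular_bimodule A)) = add A"
  "lsmult (restrict_scalars f g (regular_bimodule A)) r x = f r \<otimes>\<^bsub>A\<^esub> x"
  "rsmult (restrict_scalars f g (regular_bimodule A)) x s = x \<otimes>\<^bsub>A\<^esub> g s"
  by (simp_all add: restrict_scalars_def regular_bimodule_def)

lemma power_bimodule_simps [simp]:
  "carrier (power_bimodule M N) = {1..N} \<rightarrow>\<^sub>E carrier M"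
  "\<zero>\<^bsub>power_bimodule M N\<^esub> = (\<lambda>i\<in>{1..N}. \<zero>\<^bsub>M\<^esub>)"
  "add (power_bimodule M N) v w = (\<lambda>i\<in>{1..N}. v i \<oplus>\<^bsub>M\<^esub> w i)"
  "lsmult (power_bimodule M N) r v = (\<lambda>i\<in>{1..N}. lsmult M r (v i))"
  "rsmult (power_bimodule M N) v s = (\<lambda>i\<in>{1..N}. rsmult M (v i) s)"
  by (simp_all add: power_bimodule_def)

lemma power_basis_closed: "ring A \<Longrightarrow> power_basis A N i \<in> {1..N} \<rightarrow>\<^sub>E carrier A"
  by (auto simp: power_basis_def ring.ring_simprules)

text \<open>The entries are 0 and 1, which commute with everything. This is why the image of a basis
  vector under an A-C-homomorphism centralizes \<open>C\<close>.\<close>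

lemma power_basis_central:
  assumes "ring A" "c \<in> carrier A"
  shows "(\<lambda>j\<in>{1..N}. c \<otimes>\<^bsub>A\<^esub> power_basis A N i j) = (\<lambda>j\<in>{1..N}. power_basis A N i j \<otimes>\<^bsub>A\<^esub> c)"
proof -
  interpret ring A by fact
  show ?thesis using assms(2) by (auto simp: power_basis_def fun_eq_iff)
qed

text \<open>Together with additivity and left linearity, this determines a homomorphism out of A^N
  by its values on the basis vectors.\<close>

lemma power_basis_expansion:
  assumes "ring A" "ring C" "\<chi> \<in> ring_hom C A" "v \<in> {1..N} \<rightarrow>\<^sub>E carrier A"
  defines "V \<equiv> power_bimodule (restrict_scalars id \<chi> (regular_bimodule A)) N"
  shows "v = (\<Oplus>\<^bsub>V\<^esub>i\<in>{1..N}. lsmult V (v i) (power_basis A N i))"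
proof (rule extensionalityI[of _ "{1..N}"])
  interpret A: ring A by fact
  interpret V: bimodule A C V
    unfolding V_def using assms(1-3) by (intro bimodule_power bimodule_restrict_regular) auto
  have v: "v i \<in> carrier A" if "i \<in> {1..N}" for i
    using PiE_mem[OF assms(4) that] .
  have terms: "(\<lambda>i. lsmult V (v i) (power_basis A N i)) \<in> {1..N} \<rightarrow> carrier V"
    using v PiE_mem[OF power_basis_closed[OF assms(1)]] by (auto simp: V_def)
  show "v \<in> extensional {1..N}" using assms(4) by (auto simp: PiE_def)
  show "(\<Oplus>\<^bsub>V\<^esub>i\<in>{1..N}. lsmult V (v i) (power_basis A N i)) \<in> extensional {1..N}"
    using V.finsum_closed[OF terms] by (simp add: V_def PiE_def)
  fix j assume j: "j \<in> {1..N}"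
  \<comment> \<open>Evaluation at coordinate \<open>j\<close> is additive, so it passes through the
    sum, where only the term with index \<open>j\<close> survives.\<close>
  have "abelian_group_hom V A (\<lambda>w. w j)"
    using j by (intro abelian_group_homI V.abelian_group_axioms A.abelian_group_axioms group_hom.intro
        group_hom_axioms.intro V.a_group A.a_group) (auto simp: hom_def V_def)
  from abelian_group_hom.hom_finsum[OF this _ terms]
  have "(\<Oplus>\<^bsub>V\<^esub>i\<in>{1..N}. lsmult V (v i) (power_basis A N i)) j =
      (\<Oplus>\<^bsub>A\<^esub>i\<in>{1..N}. lsmult V (v i) (power_basis A N i) j)" by simp
  also have "\<dots> = (\<Oplus>\<^bsub>A\<^esub>i\<in>{1..N}. if j = i then v i else \<zero>\<^bsub>A\<^esub>)"
    using v j by (intro A.finsum_cong') (auto simp: V_def power_basis_def)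
  also have "\<dots> = v j"
    using v j by (intro A.add.finprod_singleton) auto
  finally show "v j = (\<Oplus>\<^bsub>V\<^esub>i\<in>{1..N}. lsmult V (v i) (power_basis A N i)) j" ..
qed


text \<open>Additivity and left linearity hold for any choice of \<open>u\<close>; the hypothesis
  \<open>central\<close> is what right linearity over \<open>C\<close> requires.\<close>

lemma combination_bimodule_hom:
  assumes "ring A" "ring C" "\<chi> \<in> ring_hom C A" "bimodule A C M"
    and u: "\<And>i. i \<in> {1..N} \<Longrightarrow> u i \<in> carrier M"
    and central: "\<And>i c. \<lbrakk>i \<in> {1..N}; c \<in> carrier C\<rbrakk> \<Longrightarrow> lsmult M (\<chi> c) (u i) = rsmult M (u i) c"
  shows "(\<lambda>v. \<Oplus>\<^bsub>M\<^esub>i\<in>{1..N}. lsmult M (v i) (u i))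
    \<in> bimodule_hom A C (power_bimodule (restrict_scalars id \<chi> (regular_bimodule A)) N) M"
proof -
  interpret A: ring A by fact
  interpret M: bimodule A C M by fact
  have closed: "lsmult M (v i) (u i) \<in> carrier M" if "v \<in> {1..N} \<rightarrow>\<^sub>E carrier A" "i \<in> {1..N}" for v i
    using PiE_mem[OF that] u[OF that(2)] by (rule M.lsmult_closed)
  show ?thesis
  proof (rule bimodule_homI)
    show "(\<lambda>v. \<Oplus>\<^bsub>M\<^esub>i\<in>{1..N}. lsmult M (v i) (u i))
        \<in> carrier (power_bimodule (restrict_scalars id \<chi> (regular_bimodule A)) N) \<rightarrow> carrier M"
      using closed by (auto intro!: M.finsum_closed)
  next
    fix v w
    assume "v \<in> carrier (power_bimodule (restrict_scalars id \<chi> (regular_bimodule A)) N)"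
      and "w \<in> carrier (power_bimodule (restrict_scalars id \<chi> (regular_bimodule A)) N)"
    then have v: "v \<in> {1..N} \<rightarrow>\<^sub>E carrier A" and w: "w \<in> {1..N} \<rightarrow>\<^sub>E carrier A" by simp_all
    have "(\<Oplus>\<^bsub>M\<^esub>i\<in>{1..N}. lsmult M ((\<lambda>i\<in>{1..N}. v i \<oplus>\<^bsub>A\<^esub> w i) i) (u i)) =
        (\<Oplus>\<^bsub>M\<^esub>i\<in>{1..N}. lsmult M (v i) (u i) \<oplus>\<^bsub>M\<^esub> lsmult M (w i) (u i))"
      using closed[OF v] closed[OF w] u PiE_mem[OF v] PiE_mem[OF w]
      by (intro M.finsum_cong') (auto simp: M.add_lsmult)
    also have "\<dots> = (\<Oplus>\<^bsub>M\<^esub>i\<in>{1..N}. lsmult M (v i) (u i)) \<oplus>\<^bsub>M\<^esub> (\<Oplus>\<^bsub>M\<^esub>i\<in>{1..N}. lsmult M (w i) (u i))"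
      using closed[OF v] closed[OF w] by (intro M.finsum_addf) auto
    finally show "(\<Oplus>\<^bsub>M\<^esub>i\<in>{1..N}. lsmult M
          ((v \<oplus>\<^bsub>power_bimodule (restrict_scalars id \<chi> (regular_bimodule A)) N\<^esub> w) i) (u i)) =
        (\<Oplus>\<^bsub>M\<^esub>i\<in>{1..N}. lsmult M (v i) (u i)) \<oplus>\<^bsub>M\<^esub> (\<Oplus>\<^bsub>M\<^esub>i\<in>{1..N}. lsmult M (w i) (u i))"
      by simp
  next
    fix r v
    assume r: "r \<in> carrier A"
      and "v \<in> carrier (power_bimodule (restrict_scalars id \<chi> (regular_bimodule A)) N)"
    then have v: "v \<in> {1..N} \<rightarrow>\<^sub>E carrier A" by simp
    have "(\<Oplus>\<^bsub>M\<^esub>i\<in>{1..N}. lsmult M ((\<lambda>i\<in>{1..N}. r \<otimes>\<^bsub>A\<^esub> v i) i) (u i)) =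
        (\<Oplus>\<^bsub>M\<^esub>i\<in>{1..N}. lsmult M r (lsmult M (v i) (u i)))"
      using closed[OF v] u PiE_mem[OF v] r
      by (intro M.finsum_cong') (auto simp: M.mult_lsmult M.lsmult_closed)
    also have "\<dots> = lsmult M r (\<Oplus>\<^bsub>M\<^esub>i\<in>{1..N}. lsmult M (v i) (u i))"
      using closed[OF v] r by (intro M.finsum_lsmult[symmetric]) auto
    finally show "(\<Oplus>\<^bsub>M\<^esub>i\<in>{1..N}. lsmult M
          (lsmult (power_bimodule (restrict_scalars id \<chi> (regular_bimodule A)) N) r v i) (u i)) =
        lsmult M r (\<Oplus>\<^bsub>M\<^esub>i\<in>{1..N}. lsmult M (v i) (u i))"
      by simp
  next
    fix c v
    assume c: "c \<in> carrier C"
      and "v \<in> carrier (power_bimodule (restrict_scalars id \<chi> (regular_bimodule A)) N)"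
    then have v: "v \<in> {1..N} \<rightarrow>\<^sub>E carrier A" by simp
    have \<chi>c: "\<chi> c \<in> carrier A" using c assms(3) by (rule ring_hom_closed[rotated])
    \<comment> \<open>Termwise, (v_i chi(c)) u_i = v_i (chi(c) u_i) = v_i (u_i c) = (v_i u_i) c,
      where the middle equality is \<open>central\<close>.\<close>
    have "(\<Oplus>\<^bsub>M\<^esub>i\<in>{1..N}. lsmult M ((\<lambda>i\<in>{1..N}. v i \<otimes>\<^bsub>A\<^esub> \<chi> c) i) (u i)) =
        (\<Oplus>\<^bsub>M\<^esub>i\<in>{1..N}. rsmult M (lsmult M (v i) (u i)) c)"
      using closed[OF v] u PiE_mem[OF v] c \<chi>c
      by (intro M.finsum_cong') (auto simp: M.mult_lsmult M.lsmult_rsmult central intro!: M.lsmult_closed M.rsmult_closed)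
    also have "\<dots> = rsmult M (\<Oplus>\<^bsub>M\<^esub>i\<in>{1..N}. lsmult M (v i) (u i)) c"
      using closed[OF v] c by (intro M.finsum_rsmult[symmetric]) auto
    finally show "(\<Oplus>\<^bsub>M\<^esub>i\<in>{1..N}. lsmult M
          (rsmult (power_bimodule (restrict_scalars id \<chi> (regular_bimodule A)) N) v c i) (u i)) =
        rsmult M (\<Oplus>\<^bsub>M\<^esub>i\<in>{1..N}. lsmult M (v i) (u i)) c"
      by simp
  qed
qed

section \<open>Right depth three through endomorphisms and centralizing tensors\<close>

theorem theorem2p6:
  fixes A :: "('a, 'm) ring_scheme"
    and B :: "('b, 'n) ring_scheme"
    and C :: "('c, 'k) ring_scheme"
    and \<phi> :: "'c \<Rightarrow> 'b" and \<psi> :: "'b \<Rightarrow> 'a"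
  assumes "ring_tower A B C \<phi> \<psi>"
  shows "right_depth_three A B C \<phi> \<psi> \<longleftrightarrow>
    (\<exists>(N::nat) (\<gamma> :: nat \<Rightarrow> 'a \<Rightarrow> 'a) (u :: nat \<Rightarrow> (('a \<times> 'a) \<Rightarrow>\<^sub>0 int) set).
      N \<ge> 1 \<and>
      (\<forall>i\<in>{1..N}. \<gamma> i \<in> End_BAC A B C \<phi> \<psi>) \<and>
      (\<forall>i\<in>{1..N}. u i \<in> tensor_square_centralizer A B C \<phi> \<psi>) \<and>
      (\<forall>x\<in>carrier A. \<forall>y\<in>carrier A.
        pure_tensor A B \<psi> x y =
          (\<Oplus>\<^bsub>tensor_square A B \<psi>\<^esub>i\<in>{1..N}.
            lsmult (tensor_square A B \<psi>) (x \<otimes>\<^bsub>A\<^esub> \<gamma> i y) (u i))))"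
proof -
  interpret ring_tower A B C \<phi> \<psi> by fact
  define \<chi> where "\<chi> = \<psi> \<circ> \<phi>"
  have \<chi>: "\<chi> \<in> ring_hom C A"
    unfolding \<chi>_def using phi_hom psi_hom by (rule ring_hom_trans)
  note rings = A.ring_axioms B.ring_axioms C.ring_axioms
  define AB where "AB = (restrict_scalars id \<psi> (regular_bimodule A) :: ('a, 'b, 'a) bimodule)"
  \<comment> \<open>This bimodule has two roles: it is the right factor of the tensor product, and
    its endomorphisms are those in \<open>End_BAC\<close>.\<close>
  define BC where "BC = (restrict_scalars \<psi> \<chi> (regular_bimodule A) :: ('b, 'c, 'a) bimodule)"
  define AC where "AC = (restrict_scalars id \<chi> (regular_bimodule A) :: ('a, 'c, 'a) bimodule)"
  interpret T: tensor_product A B C AB BC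
    unfolding AB_def BC_def
    by (intro tensor_product.intro bimodule_restrict_regular rings \<chi> psi_hom id_ring_hom)
  let ?T = "tensor_bimodule AB B BC"
  interpret T: bimodule A C ?T by (rule T.bimodule_tensor)
  have V: "bimodule A C (power_bimodule AC N)" for N
    unfolding AC_def by (intro bimodule_power bimodule_restrict_regular rings \<chi> id_ring_hom)
  have T_eq: "restrict_scalars id \<chi> (tensor_square A B \<psi>) = ?T"
    unfolding tensor_square_def restrict_scalars_tensor AB_def BC_def
    by (simp add: restrict_scalars_def)
  \<comment> \<open>The tensor relations do not involve the right action on the second factor.
    Restricting that action to \<open>C\<close> therefore leaves the cosets, their addition and the
    left action of \<open>A\<close> literally the same, and all notions of the statement can be
    moved to \<open>?T\<close>.\<close>
  have pure_eq: "pure_tensor A B \<psi> = tensor_elem AB B BC"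
    by (simp add: pure_tensor_def tensor_elem_def tensor_relations_def AB_def BC_def fun_eq_iff)
  have lsmult_eq: "lsmult (tensor_square A B \<psi>) = lsmult ?T"
    unfolding T_eq[symmetric] by (simp add: restrict_scalars_def)
  have finsum_eq: "finsum (tensor_square A B \<psi>) = finsum ?T"
    unfolding T_eq[symmetric] by (simp add: fun_eq_iff)
  have End_eq: "End_BAC A B C \<phi> \<psi> = bimodule_hom B C BC BC"
    by (simp add: End_BAC_def BC_def \<chi>_def)
  have centralizer_eq: "tensor_square_centralizer A B C \<phi> \<psi> =
      {p \<in> carrier ?T. \<forall>c\<in>carrier C. lsmult ?T (\<chi> c) p = rsmult ?T p c}"
    unfolding T_eq[symmetric] \<chi>_def
    by (simp add: tensor_square_centralizer_def centralizer_def restrict_scalars_def)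
  have depth_eq: "right_depth_three A B C \<phi> \<psi> \<longleftrightarrow>
      (\<exists>N\<ge>1. \<exists>g\<in>bimodule_hom A C ?T (power_bimodule AC N). \<exists>f\<in>bimodule_hom A C (power_bimodule AC N) ?T.
        \<forall>t\<in>carrier ?T. f (g t) = t)"
    unfolding right_depth_three_def Let_def \<chi>_def[symmetric] T_eq AC_def[symmetric]
      direct_summand_iso_iff_retract[OF T.bimodule_axioms V] ..
  have AB_simps: "carrier AB = carrier A" "add AB = add A" "lsmult AB a x = a \<otimes>\<^bsub>A\<^esub> x" "rsmult AB x b = x \<otimes>\<^bsub>A\<^esub> \<psi> b"
    for a x b by (simp_all add: AB_def)
  have BC_simps: "carrier BC = carrier A" "add BC = add A" "lsmult BC b x = \<psi> b \<otimes>\<^bsub>A\<^esub> x" "rsmult BC x c = x \<otimes>\<^bsub>A\<^esub> \<chi> c"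
    for b x c by (simp_all add: BC_def)
  have AC_simps: "carrier AC = carrier A" "add AC = add A" "lsmult AC a x = a \<otimes>\<^bsub>A\<^esub> x" "rsmult AC x c = x \<otimes>\<^bsub>A\<^esub> \<chi> c"
    for a x c by (simp_all add: AC_def)
  note [simp] = AB_simps BC_simps AC_simps
    and [simp] = ring_hom_closed[OF psi_hom] ring_hom_closed[OF \<chi>]
  note tensor = T.tensor_elem_props[simplified]
  show ?thesis
    unfolding depth_eq pure_eq lsmult_eq finsum_eq End_eq centralizer_eq
  proof (intro iffI; elim exE conjE bexE)
    fix N g f
    assume N: "1 \<le> N" and g: "g \<in> bimodule_hom A C ?T (power_bimodule AC N)"
      and f: "f \<in> bimodule_hom A C (power_bimodule AC N) ?T"
      and fg: "\<forall>t\<in>carrier ?T. f (g t) = t"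
    interpret V: bimodule A C "power_bimodule AC N" by (rule V)
    interpret f: abelian_group_hom "power_bimodule AC N" ?T f
      using f by (intro bimodule_hom_abelian_group_hom) unfold_locales
    note gD = bimodule_homD[OF g] and fD = bimodule_homD[OF f]
    define \<gamma> where "\<gamma> i y = g (tensor_elem AB B BC \<one>\<^bsub>A\<^esub> y) i" for i y
    define u where "u i = f (power_basis A N i)" for i
    have basis: "power_basis A N i \<in> carrier (power_bimodule AC N)" for i
      using power_basis_closed[OF A.ring_axioms] by simp
    have g_PiE: "g t \<in> {1..N} \<rightarrow>\<^sub>E carrier A" if "t \<in> carrier ?T" for t
      using gD(1)[OF that] by simp
    have \<gamma>_hom: "\<gamma> i \<in> bimodule_hom B C BC BC" if i: "i \<in> {1..N}" for i
    proof (rule bimodule_homI)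
      show "\<gamma> i \<in> carrier BC \<rightarrow> carrier BC"
        using i PiE_mem[OF g_PiE] by (auto simp: \<gamma>_def tensor(1))
    next
      fix x y assume "x \<in> carrier BC" "y \<in> carrier BC"
      then show "\<gamma> i (x \<oplus>\<^bsub>BC\<^esub> y) = \<gamma> i x \<oplus>\<^bsub>BC\<^esub> \<gamma> i y"
        using i by (simp add: \<gamma>_def tensor gD)
    next
      \<comment> \<open>The scalar crosses the tensor sign: 1 tensor psi(b)x equals psi(b) tensor x,
        which is psi(b) acting on 1 tensor x. Left linearity of \<open>g\<close> over
        \<open>A\<close> thus yields linearity of \<open>\<gamma> i\<close> over
        \<open>B\<close>.\<close>
      fix b x assume b: "b \<in> carrier B" and x: "x \<in> carrier BC"
      then have "tensor_elem AB B BC \<one>\<^bsub>A\<^esub> (\<psi> b \<otimes>\<^bsub>A\<^esub> x) = lsmult ?T (\<psi> b) (tensor_elem AB B BC \<one>\<^bsub>A\<^esub> x)"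
        using tensor(4)[of "\<one>\<^bsub>A\<^esub>" x b] by (simp add: tensor(2))
      then show "\<gamma> i (lsmult BC b x) = lsmult BC b (\<gamma> i x)"
        using i b x by (simp add: \<gamma>_def tensor(1) gD(3))
    next
      fix c x assume c: "c \<in> carrier C" and x: "x \<in> carrier BC"
      then have "tensor_elem AB B BC \<one>\<^bsub>A\<^esub> (x \<otimes>\<^bsub>A\<^esub> \<chi> c) = rsmult ?T (tensor_elem AB B BC \<one>\<^bsub>A\<^esub> x) c"
        by (simp add: tensor(3))
      then show "\<gamma> i (rsmult BC x c) = rsmult BC (\<gamma> i x) c"
        using i c x by (simp add: \<gamma>_def tensor(1) gD(4))
    qed
    \<comment> \<open>For the basis vector e_i, chi(c) f(e_i) = f(chi(c) e_i) = f(e_i c) = f(e_i)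
      c.\<close>
    have u_central: "u i \<in> {p \<in> carrier ?T. \<forall>c\<in>carrier C. lsmult ?T (\<chi> c) p = rsmult ?T p c}" for i
      using fD(1)[OF basis] fD(3)[OF _ basis, symmetric] fD(4)[OF _ basis, symmetric]
        power_basis_central[OF A.ring_axioms, of "\<chi> _" N i]
      by (simp add: u_def)
    have expansion: "tensor_elem AB B BC x y = (\<Oplus>\<^bsub>?T\<^esub>i\<in>{1..N}. lsmult ?T (x \<otimes>\<^bsub>A\<^esub> \<gamma> i y) (u i))"
      if x: "x \<in> carrier A" and y: "y \<in> carrier A" for x y
    proof -
      define v where "v = g (tensor_elem AB B BC x y)"
      have v: "v \<in> {1..N} \<rightarrow>\<^sub>E carrier A"
        unfolding v_def using x y by (intro g_PiE tensor(1))
      \<comment> \<open>Since x tensor y is x acting on 1 tensor y, left linearity of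
        \<open>g\<close> reduces its values to those that define \<open>\<gamma>\<close>.\<close>
      have v_eq: "v i = x \<otimes>\<^bsub>A\<^esub> \<gamma> i y" if "i \<in> {1..N}" for i
      proof -
        have "tensor_elem AB B BC x y = lsmult ?T x (tensor_elem AB B BC \<one>\<^bsub>A\<^esub> y)"
          using x y by (simp add: tensor(2))
        then show ?thesis
          using x y that by (simp add: v_def \<gamma>_def tensor(1) gD(3))
      qed
      have v_closed: "v i \<in> carrier A" if "i \<in> {1..N}" for i using PiE_mem[OF v that] .
      have "tensor_elem AB B BC x y = f v"
        using fg x y by (simp add: v_def tensor(1))
      also have "\<dots> = f (\<Oplus>\<^bsub>power_bimodule AC N\<^esub>i\<in>{1..N}. lsmult (power_bimodule AC N) (v i) (power_basis A N i))"
        using power_basis_expansion[OF A.ring_axioms C.ring_axioms \<chi> v] by (simp add: AC_def)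
      also have "\<dots> = (\<Oplus>\<^bsub>?T\<^esub>i\<in>{1..N}. f (lsmult (power_bimodule AC N) (v i) (power_basis A N i)))"
        using v_closed basis by (intro f.hom_finsum) (auto intro!: V.lsmult_closed simp del: power_bimodule_simps)
      also have "\<dots> = (\<Oplus>\<^bsub>?T\<^esub>i\<in>{1..N}. lsmult ?T (x \<otimes>\<^bsub>A\<^esub> \<gamma> i y) (u i))"
      proof (rule T.finsum_cong')
        show "(\<lambda>i. lsmult ?T (x \<otimes>\<^bsub>A\<^esub> \<gamma> i y) (u i)) \<in> {1..N} \<rightarrow> carrier ?T"
          using v_closed v_eq fD(1)[OF basis] by (auto simp: u_def intro!: T.lsmult_closed)
        fix i assume i: "i \<in> {1..N}"
        show "f (lsmult (power_bimodule AC N) (v i) (power_basis A N i)) = lsmult ?T (x \<otimes>\<^bsub>A\<^esub> \<gamma> i y) (u i)"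
          using fD(3)[OF v_closed[OF i] basis] v_eq[OF i] by (simp only: u_def)
      qed simp
      finally show ?thesis .
    qed
    show "\<exists>(N::nat) \<gamma> u. 1 \<le> N \<and> (\<forall>i\<in>{1..N}. \<gamma> i \<in> bimodule_hom B C BC BC) \<and>
        (\<forall>i\<in>{1..N}. u i \<in> {p \<in> carrier ?T. \<forall>c\<in>carrier C. lsmult ?T (\<chi> c) p = rsmult ?T p c}) \<and>
        (\<forall>x\<in>carrier A. \<forall>y\<in>carrier A. tensor_elem AB B BC x y =
          (\<Oplus>\<^bsub>?T\<^esub>i\<in>{1..N}. lsmult ?T (x \<otimes>\<^bsub>A\<^esub> \<gamma> i y) (u i)))"
      by (intro exI[of _ N] exI[of _ \<gamma>] exI[of _ u] conjI ballI N \<gamma>_hom u_central expansion)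
  next
    fix N :: nat and \<gamma> u
    assume N: "1 \<le> N" and \<gamma>: "\<forall>i\<in>{1..N}. \<gamma> i \<in> bimodule_hom B C BC BC"
      and u: "\<forall>i\<in>{1..N}. u i \<in> {p \<in> carrier ?T. \<forall>c\<in>carrier C. lsmult ?T (\<chi> c) p = rsmult ?T p c}"
      and eq: "\<forall>x\<in>carrier A. \<forall>y\<in>carrier A. tensor_elem AB B BC x y =
          (\<Oplus>\<^bsub>?T\<^esub>i\<in>{1..N}. lsmult ?T (x \<otimes>\<^bsub>A\<^esub> \<gamma> i y) (u i))"
    interpret V: bimodule A C "power_bimodule AC N" by (rule V)
    note \<gamma>D = bimodule_homD[OF \<gamma>[rule_format], simplified]
    \<comment> \<open>Linearity of each \<open>\<gamma> i\<close> over \<open>B\<close> on the left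
      makes the map balanced, and linearity over \<open>C\<close> on the right gives its
      compatibility with the right action.\<close>
    obtain g where g: "g \<in> bimodule_hom A C ?T (power_bimodule AC N)"
      and g_tensor: "\<And>x y. \<lbrakk>x \<in> carrier A; y \<in> carrier A\<rbrakk>
        \<Longrightarrow> g (tensor_elem AB B BC x y) = (\<lambda>i\<in>{1..N}. x \<otimes>\<^bsub>A\<^esub> \<gamma> i y)"
      by (rule T.tensor_bimodule_hom_lift[OF V, where f = "\<lambda>x y. \<lambda>i\<in>{1..N}. x \<otimes>\<^bsub>A\<^esub> \<gamma> i y"])
        (auto simp: fun_eq_iff \<gamma>D A.l_distr A.r_distr A.m_assoc)
    define f where "f v = (\<Oplus>\<^bsub>?T\<^esub>i\<in>{1..N}. lsmult ?T (v i) (u i))" for v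
    have f: "f \<in> bimodule_hom A C (power_bimodule AC N) ?T"
      unfolding f_def AC_def using u
      by (intro combination_bimodule_hom A.ring_axioms C.ring_axioms \<chi> T.bimodule_axioms) auto
    interpret g: abelian_group_hom ?T "power_bimodule AC N" g
      using g by (intro bimodule_hom_abelian_group_hom) unfold_locales
    interpret f: abelian_group_hom "power_bimodule AC N" ?T f
      using f by (intro bimodule_hom_abelian_group_hom) unfold_locales
    \<comment> \<open>Both sides are additive in \<open>t\<close>, so pure tensors suffice, and
      there the claim is the assumed equation \<open>eq\<close>.\<close>
    have "f (g t) = t" if "t \<in> carrier ?T" for t
    proof (rule T.tensor_hom_ext[OF _ _ _ that])
      show "abelian_group_hom ?T ?T (\<lambda>t. f (g t))" "abelian_group_hom ?T ?T (\<lambda>t. t)"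
        by (intro abelian_group_homI T.abelian_group_axioms group_hom.intro group_hom_axioms.intro T.a_group;
            auto simp: hom_def simp del: power_bimodule_simps)+
    next
      fix x y assume "x \<in> carrier AB" "y \<in> carrier BC"
      then have x: "x \<in> carrier A" and y: "y \<in> carrier A" by simp_all
      have "f (g (tensor_elem AB B BC x y)) = (\<Oplus>\<^bsub>?T\<^esub>i\<in>{1..N}. lsmult ?T (x \<otimes>\<^bsub>A\<^esub> \<gamma> i y) (u i))"
        unfolding f_def using x y u
        by (intro T.finsum_cong') (auto simp: g_tensor \<gamma>D intro!: T.lsmult_closed)
      then show "f (g (tensor_elem AB B BC x y)) = tensor_elem AB B BC x y"
        using eq x y by simp
    qed
    then show "\<exists>N\<ge>1. \<exists>g\<in>bimodule_hom A C ?T (power_bimodule AC N).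
        \<exists>f\<in>bimodule_hom A C (power_bimodule AC N) ?T. \<forall>t\<in>carrier ?T. f (g t) = t"
      using N f g by blast
  qed
qed

end
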